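(* For every prime $p$ there exists $n_0\in\mathbb{N}$ such that for all $n\ge n_0$ and all $\varepsilon\in(0,\frac{p-1}{2p}]$, every $t$-online-erasure-resilient $\varepsilon$-tester for homomorphism of functions $f:\mathbb{F}_p^n\to\mathbb{F}_p$ must make $\Omega(\log_p t)$ queries.
   Context: A homomorphism $h:\mathbb{F}_p^n\to\mathbb{F}_p$ is an additive group homomorphism. $f$ is $\varepsilon$-far from being a homomorphism if $\Pr_x[f(x)\ne h(x)]>\varepsilon$ for every homomorphism $h$. A $t$-online-erasure-resilient $\varepsilon$-tester accesses $f$ via an oracle for $f'$ (initially $f$), where after each answered query an adversary that knows all previous queries may erase $t$ values (replace them by $\perp$); for every adversarial strategy the tester must accept homomorphisms with probability $\ge 2/3$ and reject $\varepsilon$-far functions with probability $\ge 2/3$. $\Omega(\cdot)$ hides an absolute constant. *)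

theory Defs
  imports "HOL-Probability.Probability" "HOL-Algebra.Product_Groups"
    "HOL-Computational_Algebra.Primes"
begin

text \<open>
  A deterministic query algorithm is a decision tree; the answer to a query is \<open>None\<close> (an erased
  value) or \<open>Some y\<close>. A randomized algorithm is a \<open>pmf\<close> on decision trees: the coins are drawn
  beforehand, and an adversary never sees them.
\<close>

datatype (query_points: 'a, dead 'b) decision_tree =
  Decide bool
| Query 'a "'b option \<Rightarrow> ('a, 'b) decision_tree"

text \<open>
  An adversary strategy maps the nonempty list of queries made so far to the set of points erased
  right after the last of them has been answered. Strategies are quantified after the input and the
  tester, so they may depend on both; the answers given so far are determined by the input and the
  queries. A randomized strategy is a mixture of such deterministic ones and imposes no additional
  requirement on a tester.
\<close>

type_synonym 'a adversary = "'a list \<Rightarrow> 'a set"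

definition online_erasure_adversary :: "'a set \<Rightarrow> nat \<Rightarrow> 'a adversary \<Rightarrow> bool" where
  "online_erasure_adversary D t A \<longleftrightarrow> (\<forall>qs. A qs \<subseteq> D \<and> finite (A qs) \<and> card (A qs) \<le> t)"

text \<open>In \<open>exec A f qs E\<close>, \<open>qs\<close> are the queries already made and \<open>E\<close> the points already erased.
  The result is the verdict (\<open>True\<close> for acceptance) and the number of further queries made.\<close>

primrec exec ::
  "'a adversary \<Rightarrow> ('a \<Rightarrow> 'b) \<Rightarrow> 'a list \<Rightarrow> 'a set \<Rightarrow> ('a, 'b) decision_tree \<Rightarrow> bool \<times> nat" where
  "exec A f qs E (Decide b) = (b, 0)"
| "exec A f qs E (Query x k) =
     (let qs' = qs @ [x];
          (b, m) = exec A f qs' (E \<union> A qs') (k (if x \<in> E then None else Some (f x)))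
      in (b, Suc m))"

definition accepts :: "'a adversary \<Rightarrow> ('a \<Rightarrow> 'b) \<Rightarrow> ('a, 'b) decision_tree \<Rightarrow> bool" where
  "accepts A f T = fst (exec A f [] {} T)"

definition num_queries :: "'a adversary \<Rightarrow> ('a \<Rightarrow> 'b) \<Rightarrow> ('a, 'b) decision_tree \<Rightarrow> nat" where
  "num_queries A f T = snd (exec A f [] {} T)"

definition eps_far :: "'a set \<Rightarrow> ('a \<Rightarrow> 'b) set \<Rightarrow> real \<Rightarrow> ('a \<Rightarrow> 'b) \<Rightarrow> bool" where
  "eps_far D P \<epsilon> f \<longleftrightarrow> (\<forall>h\<in>P. measure_pmf.prob (pmf_of_set D) {x. f x \<noteq> h x} > \<epsilon>)"

definition online_erasure_resilient_tester ::
  "'a set \<Rightarrow> 'b set \<Rightarrow> ('a \<Rightarrow> 'b) set \<Rightarrow> nat \<Rightarrow> real \<Rightarrow> ('a, 'b) decision_tree pmf \<Rightarrow> bool" where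
  "online_erasure_resilient_tester D R P t \<epsilon> M \<longleftrightarrow>
     (\<forall>T\<in>set_pmf M. query_points T \<subseteq> D) \<and>
     (\<forall>f\<in>D \<rightarrow> R. \<forall>A. online_erasure_adversary D t A \<longrightarrow>
        (f \<in> P \<longrightarrow> measure_pmf.prob M {T. accepts A f T} \<ge> 2/3) \<and>
        (eps_far D P \<epsilon> f \<longrightarrow> measure_pmf.prob M {T. \<not> accepts A f T} \<ge> 2/3))"

definition makes_at_most ::
  "'a set \<Rightarrow> 'b set \<Rightarrow> nat \<Rightarrow> ('a, 'b) decision_tree pmf \<Rightarrow> nat \<Rightarrow> bool" where
  "makes_at_most D R t M q \<longleftrightarrow>
     (\<forall>f\<in>D \<rightarrow> R. \<forall>A. online_erasure_adversary D t A \<longrightarrow>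
        (\<forall>T\<in>set_pmf M. num_queries A f T \<le> q))"

text \<open>The additive groups of \<open>\<F>\<^sub>p\<close> (as integers modulo \<open>p\<close>) and \<open>\<F>\<^sub>p\<^sup>n\<close>; their addition is the
  group operation \<open>mult\<close> of the record.\<close>

abbreviation Fp :: "nat \<Rightarrow> int monoid" where
  "Fp p \<equiv> integer_mod_group p"

abbreviation Fpn :: "nat \<Rightarrow> nat \<Rightarrow> (nat \<Rightarrow> int) monoid" where
  "Fpn p n \<equiv> product_group {..<n} (\<lambda>_. Fp p)"

definition homomorphism_tester ::
  "nat \<Rightarrow> nat \<Rightarrow> nat \<Rightarrow> real \<Rightarrow> (nat \<Rightarrow> int, int) decision_tree pmf \<Rightarrow> bool" where
  "homomorphism_tester p n t \<epsilon> M \<longleftrightarrow>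
     online_erasure_resilient_tester (carrier (Fpn p n)) (carrier (Fp p)) (hom (Fpn p n) (Fp p)) t \<epsilon> M"

end

theory Submission
  imports Defs "HOL-Number_Theory.Cong"
begin

text \<open>
  The adversary erases, after each query, the whole span of the queries made so far, which has at
  most \<open>p ^ q\<close> elements after \<open>q\<close> queries. Every answer that the tester then sees is the value at \<open>0\<close> or belongs to
  a point independent of the earlier ones. Let \<open>u\<close> be fixed with \<open>u 0 = 0\<close> and let \<open>l\<close> be a
  uniformly random linear form: the answers of \<open>u + l\<close> at independent points are uniform, so the
  acceptance probability does not depend on \<open>u\<close>. Taking \<open>u = 0\<close> gives homomorphisms, while
  \<open>u = x\<^sub>0 x\<^sub>1 + x\<^sub>2 x\<^sub>3\<close> agrees with any homomorphism on a fraction of at most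
  \<open>1/p + 1/p\<^sup>2 - 1/p\<^sup>3 < (p + 1)/(2p)\<close> of the points.
\<close>

section \<open>Execution of a single query\<close>

lemma fst_exec_Query:
  "fst (exec A f qs E (Query x k)) =
     fst (exec A f (qs @ [x]) (E \<union> A (qs @ [x])) (k (if x \<in> E then None else Some (f x))))"
  by (simp add: Let_def case_prod_beta)

lemma snd_exec_Query:
  "snd (exec A f qs E (Query x k)) =
     Suc (snd (exec A f (qs @ [x]) (E \<union> A (qs @ [x])) (k (if x \<in> E then None else Some (f x)))))"
  by (simp add: Let_def case_prod_beta)

section \<open>Vectors over F_p as integer representatives\<close>

locale prime_vector_space =
  fixes p n :: nat
  assumes prime_p: "prime p"
begin

definition vecs :: "(nat \<Rightarrow> int) set" where
  "vecs = (\<Pi>\<^sub>E i\<in>{..<n}. {0..<int p})"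

text \<open>Normal form. Computations run on arbitrary integer functions up to congruence, and
  \<open>reduce\<close> brings the result back to the canonical representatives that make up the
  carrier of \<open>Fpn p n\<close>.\<close>

definition reduce :: "(nat \<Rightarrow> int) \<Rightarrow> nat \<Rightarrow> int" where
  "reduce v = (\<lambda>i\<in>{..<n}. v i mod int p)"

definition inner :: "(nat \<Rightarrow> int) \<Rightarrow> (nat \<Rightarrow> int) \<Rightarrow> int" where
  "inner a x = (\<Sum>i<n. a i * x i)"

definition axis :: "nat \<Rightarrow> nat \<Rightarrow> int" where
  "axis i = (\<lambda>k. if k = i then 1 else 0)"

text \<open>One operation serves for addition (\<open>j = 1\<close>), subtraction
  (\<open>j = -1\<close>) and motion along a line in direction \<open>x\<close> (varying
  \<open>j\<close>), so a single rule for \<open>inner\<close> in each argument suffices.\<close>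

definition axpy :: "int \<Rightarrow> (nat \<Rightarrow> int) \<Rightarrow> (nat \<Rightarrow> int) \<Rightarrow> nat \<Rightarrow> int" where
  "axpy j x y = reduce (\<lambda>i. y i + j * x i)"

lemma p_pos: "0 < p" and p_ge_2: "2 \<le> p"
  using prime_p prime_gt_0_nat prime_ge_2_nat by auto

lemma prime_int_p: "prime (int p)"
  using prime_p by simp

lemma carrier_Fp: "carrier (Fp p) = {0..<int p}"
  using p_pos by (simp add: carrier_integer_mod_group)

lemma carrier_Fpn: "carrier (Fpn p n) = vecs"
  by (simp add: vecs_def carrier_Fp)

lemma finite_vecs: "finite vecs"
  unfolding vecs_def by (intro finite_PiE) auto

lemma reduce_in_vecs: "reduce v \<in> vecs"
  using p_pos by (auto simp: vecs_def reduce_def)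

lemma axpy_in_vecs: "axpy j x y \<in> vecs"
  by (simp add: axpy_def reduce_in_vecs)

lemma vecs_nonempty: "vecs \<noteq> {}"
  using reduce_in_vecs by blast

lemma reduce_vec: "x \<in> vecs \<Longrightarrow> reduce x = x"
  by (auto simp: vecs_def reduce_def fun_eq_iff PiE_def Pi_def extensional_def)

lemma vec_eqI:
  assumes "x \<in> vecs" "y \<in> vecs" "\<And>i. i < n \<Longrightarrow> [x i = y i] (mod int p)"
  shows "x = y"
proof -
  have "reduce x = reduce y"
    using assms(3) by (auto simp: reduce_def fun_eq_iff cong_def)
  then show ?thesis using assms by (simp add: reduce_vec)
qed

lemma axpy_cong: "i < n \<Longrightarrow> [axpy j x y i = y i + j * x i] (mod int p)"
  by (simp add: axpy_def reduce_def)

lemma inner_cong: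
  assumes "\<And>i. i < n \<Longrightarrow> [x i = y i] (mod int p)"
  shows "[inner a x = inner a y] (mod int p)"
  unfolding inner_def by (intro cong_sum cong_mult) (use assms in auto)

lemma inner_commute: "inner a x = inner x a"
  by (simp add: inner_def mult.commute)

lemma inner_axpy_right: "[inner a (axpy j x y) = inner a y + j * inner a x] (mod int p)"
proof -
  have "[inner a (axpy j x y) = inner a (\<lambda>i. y i + j * x i)] (mod int p)"
    by (intro inner_cong axpy_cong)
  also have "inner a (\<lambda>i. y i + j * x i) = inner a y + j * inner a x"
    by (simp add: inner_def algebra_simps sum.distrib sum_distrib_left)
  finally show ?thesis .
qed

lemma inner_axpy_left: "[inner (axpy j a b) x = inner b x + j * inner a x] (mod int p)"
  using inner_axpy_right[of x j a b] by (simp add: inner_commute)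

lemma inner_axis: "i < n \<Longrightarrow> inner a (axis i) = a i"
  by (simp add: inner_def axis_def if_distrib cong: if_cong)

lemma axpy_axpy: "axpy j v (axpy k v x) = axpy (j + k) v x"
proof (rule vec_eqI)
  fix i assume "i < n"
  have "[axpy j v (axpy k v x) i = axpy k v x i + j * v i] (mod int p)"
    using \<open>i < n\<close> by (rule axpy_cong)
  also have "[axpy k v x i + j * v i = (x i + k * v i) + j * v i] (mod int p)"
    using \<open>i < n\<close> by (intro cong_add axpy_cong) auto
  also have "(x i + k * v i) + j * v i = x i + (j + k) * v i"
    by (simp add: algebra_simps)
  also have "[x i + (j + k) * v i = axpy (j + k) v x i] (mod int p)"
    using \<open>i < n\<close> by (intro cong_sym[OF axpy_cong])
  finally show "[axpy j v (axpy k v x) i = axpy (j + k) v x i] (mod int p)" .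
qed (rule axpy_in_vecs)+

lemma axpy_coeff_cong:
  assumes "[j = k] (mod int p)"
  shows "axpy j v x = axpy k v x"
proof (rule vec_eqI)
  fix i assume "i < n"
  then have "[axpy j v x i = x i + j * v i] (mod int p)"
    by (rule axpy_cong)
  also have "[x i + j * v i = x i + k * v i] (mod int p)"
    using assms by (intro cong_add cong_mult) auto
  also have "[x i + k * v i = axpy k v x i] (mod int p)"
    using \<open>i < n\<close> by (intro cong_sym[OF axpy_cong])
  finally show "[axpy j v x i = axpy k v x i] (mod int p)" .
qed (rule axpy_in_vecs)+

lemma axpy_zero: "x \<in> vecs \<Longrightarrow> axpy 0 v x = x"
  by (simp add: axpy_def reduce_vec)

lemma axpy_cancel:
  assumes "x \<in> vecs" "[j + k = 0] (mod int p)"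
  shows "axpy j v (axpy k v x) = x"
  using assms axpy_coeff_cong[OF assms(2)] by (simp add: axpy_axpy axpy_zero)

lemma ex_scale:
  assumes "\<not> int p dvd s"
  obtains m where "[m * s = 1] (mod int p)"
proof -
  have "coprime s (int p)"
    using assms prime_int_p by (metis coprime_commute prime_imp_coprime)
  then show ?thesis
    using that by (metis cong_solve_coprime_int mult.commute)
qed

section \<open>Annihilators, spans and the adversary\<close>

definition annihilator :: "(nat \<Rightarrow> int) set \<Rightarrow> (nat \<Rightarrow> int) set" where
  "annihilator X = {c \<in> vecs. \<forall>x\<in>X. int p dvd inner c x}"

text \<open>By duality the double annihilator is the linear span; working with it avoids proving so.\<close>

abbreviation biannihilator :: "(nat \<Rightarrow> int) set \<Rightarrow> (nat \<Rightarrow> int) set" where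
  "biannihilator X \<equiv> annihilator (annihilator X)"

lemma finite_annihilator: "finite (annihilator X)"
  using finite_vecs by (simp add: annihilator_def)

lemma annihilator_antimono: "X \<subseteq> Y \<Longrightarrow> annihilator Y \<subseteq> annihilator X"
  by (auto simp: annihilator_def)

lemma annihilator_insert:
  "annihilator (insert x X) = {c \<in> annihilator X. int p dvd inner c x}"
  by (auto simp: annihilator_def)

text \<open>Every vector annihilates the empty set, the unit vectors included, and pairing with
  these reads off the coordinates, which must therefore all vanish.\<close>

lemma biannihilator_empty: "biannihilator {} \<subseteq> {reduce (\<lambda>_. 0)}"
proof
  fix x assume x: "x \<in> biannihilator {}"
  have "x = reduce (\<lambda>_. 0)"
  proof (rule vec_eqI)
    fix i assume i: "i < n"
    have "reduce (axis i) \<in> annihilator {}"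
      by (simp add: annihilator_def reduce_in_vecs)
    then have "int p dvd inner x (reduce (axis i))"
      using x by (auto simp: annihilator_def)
    moreover have "[inner x (reduce (axis i)) = inner x (axis i)] (mod int p)"
      by (rule inner_cong) (simp add: reduce_def)
    ultimately have "int p dvd x i"
      using i by (simp add: inner_axis cong_dvd_iff)
    then show "[x i = reduce (\<lambda>_. 0) i] (mod int p)"
      using i by (simp add: reduce_def cong_0_iff)
  qed (use x reduce_in_vecs in \<open>auto simp: annihilator_def\<close>)
  then show "x \<in> {reduce (\<lambda>_. 0)}" by simp
qed

text \<open>If \<open>x\<close> is new, some \<open>c\<close> annihilates \<open>X\<close> but not
  \<open>x\<close>. It acts as a coordinate along \<open>x\<close>: each \<open>y\<close> of the
  larger set is a multiple of \<open>x\<close> plus an element of the smaller one, and there are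
  \<open>p\<close> multiples.\<close>

lemma card_biannihilator_insert:
  assumes x: "x \<in> vecs"
  shows "card (biannihilator (insert x X)) \<le> p * card (biannihilator X)"
proof (cases "x \<in> biannihilator X")
  case True
  then have "annihilator (insert x X) = annihilator X"
    by (auto simp: annihilator_def inner_commute)
  then show ?thesis using p_pos by simp
next
  case False
  then obtain c where c: "c \<in> annihilator X" "\<not> int p dvd inner c x"
    using x by (auto simp: annihilator_def inner_commute)
  then obtain m where m: "[m * inner c x = 1] (mod int p)"
    using ex_scale by blast
  have "biannihilator (insert x X) \<subseteq>
      (\<lambda>(j, y). axpy j x y) ` ({0..<int p} \<times> biannihilator X)"
  proof
    fix y assume y: "y \<in> biannihilator (insert x X)"
    then have yv: "y \<in> vecs" by (simp add: annihilator_def)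
    \<comment> \<open>The coordinate of \<open>y\<close> along \<open>x\<close>: the form
      \<open>c\<close>, scaled by \<open>m\<close> to take the value 1 at \<open>x\<close>, is
      evaluated at \<open>y\<close>.\<close>
    define r where "r = m * inner c y"
    define y' where "y' = axpy (- r) x y"
    have "y' \<in> biannihilator X"
      unfolding annihilator_def[of "annihilator X"]
    proof (intro CollectI conjI ballI)
      show "y' \<in> vecs" by (simp add: y'_def axpy_in_vecs)
    next
      fix d assume d: "d \<in> annihilator X"
      \<comment> \<open>\<open>d\<close> is corrected by a multiple of \<open>c\<close> so as to
        vanish at \<open>x\<close> while still annihilating \<open>X\<close>. Then
        \<open>inner d' y\<close> is congruent to \<open>inner d y'\<close>, so the correction of
        \<open>y\<close> and that of \<open>d\<close> are dual to each other.\<close>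
      define d' where "d' = axpy (- (m * inner d x)) c d"
      have d': "[inner d' z = inner d z - m * inner d x * inner c z] (mod int p)" for z
        using inner_axpy_left[of "- (m * inner d x)" c d z] by (simp add: d'_def)
      have "d' \<in> annihilator (insert x X)"
        unfolding annihilator_insert annihilator_def[of X]
      proof (intro CollectI conjI ballI)
        show "d' \<in> vecs" by (simp add: d'_def axpy_in_vecs)
      next
        fix z assume "z \<in> X"
        then have "int p dvd inner d z - m * inner d x * inner c z"
          using c d by (auto simp: annihilator_def)
        then show "int p dvd inner d' z"
          using d' cong_dvd_iff by blast
      next
        have "[inner d x - inner d x * (m * inner c x) = inner d x - inner d x * 1] (mod int p)"
          using m by (intro cong_diff cong_mult) auto
        then have "int p dvd inner d x - m * inner d x * inner c x"
          by (simp add: cong_0_iff algebra_simps)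
        then show "int p dvd inner d' x"
          using d' cong_dvd_iff by blast
      qed
      then have "int p dvd inner d' y"
        using y by (auto simp: annihilator_def inner_commute)
      then have "int p dvd inner d y - m * inner d x * inner c y"
        using d' cong_dvd_iff by blast
      moreover have "[inner d y' = inner d y + (- r) * inner d x] (mod int p)"
        unfolding y'_def by (rule inner_axpy_right)
      ultimately show "int p dvd inner y' d"
        by (simp add: r_def cong_dvd_iff algebra_simps inner_commute[of y'])
    qed
    moreover have "y = axpy (r mod int p) x y'"
      unfolding y'_def by (rule sym, rule axpy_cancel) (use yv in \<open>auto simp: cong_def mod_simps\<close>)
    ultimately show "y \<in> (\<lambda>(j, y). axpy j x y) ` ({0..<int p} \<times> biannihilator X)"
      using p_pos by (intro image_eqI[of _ _ "(r mod int p, y')"]) auto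
  qed
  then have "card (biannihilator (insert x X)) \<le>
      card ((\<lambda>(j, y). axpy j x y) ` ({0..<int p} \<times> biannihilator X))"
    by (intro card_mono) (auto simp: finite_annihilator)
  also have "\<dots> \<le> card ({0..<int p} \<times> biannihilator X)"
    by (intro card_image_le) (auto simp: finite_annihilator)
  finally show ?thesis by (simp add: card_cartesian_product)
qed

lemma card_biannihilator: "set xs \<subseteq> vecs \<Longrightarrow> card (biannihilator (set xs)) \<le> p ^ length xs"
proof (induction xs)
  case Nil
  then show ?case using card_mono[OF _ biannihilator_empty] by simp
next
  case (Cons x xs)
  have "card (biannihilator (set (x # xs))) \<le> p * card (biannihilator (set xs))"
    using Cons.prems card_biannihilator_insert[of x "set xs"] by simp
  also have "\<dots> \<le> p * p ^ length xs"
    using Cons by (intro mult_left_mono) auto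
  finally show ?case by simp
qed

text \<open>The guard keeps the erasures within the budget \<open>t\<close> and the domain for every
  list of queries. It never fails within the first \<open>q\<close> queries to \<open>vecs\<close>
  if \<open>p ^ q \<le> t\<close>.\<close>

definition span_adversary :: "nat \<Rightarrow> (nat \<Rightarrow> int) adversary" where
  "span_adversary t qs =
     (if set qs \<subseteq> vecs \<and> p ^ length qs \<le> t then biannihilator (set qs) else {})"

lemma span_adversary: "online_erasure_adversary vecs t (span_adversary t)"
  unfolding online_erasure_adversary_def
proof (intro allI conjI)
  fix qs
  show "span_adversary t qs \<subseteq> vecs"
    by (simp add: span_adversary_def annihilator_def)
  show "finite (span_adversary t qs)"
    by (simp add: span_adversary_def finite_annihilator)
  show "card (span_adversary t qs) \<le> t"
    using card_biannihilator[of qs] by (auto simp: span_adversary_def)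
qed

section \<open>Conditioning a random linear form on the answers\<close>

definition shifted :: "((nat \<Rightarrow> int) \<Rightarrow> int) \<Rightarrow> (nat \<Rightarrow> int) \<Rightarrow> (nat \<Rightarrow> int) \<Rightarrow> int" where
  "shifted u a x = (u x + inner a x) mod int p"

text \<open>For \<open>a0\<close> in \<open>vecs\<close> this is the coset of
  \<open>annihilator X\<close> through \<open>a0\<close>: the forms that remain possible once the
  values on \<open>X\<close> are known.\<close>

definition agreeing :: "(nat \<Rightarrow> int) set \<Rightarrow> (nat \<Rightarrow> int) \<Rightarrow> (nat \<Rightarrow> int) set" where
  "agreeing X a0 = {a \<in> vecs. \<forall>x\<in>X. [inner a x = inner a0 x] (mod int p)}"

lemma finite_agreeing: "finite (agreeing X a)"
  using finite_vecs by (simp add: agreeing_def)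

lemma agreeing_self: "a \<in> vecs \<Longrightarrow> a \<in> agreeing X a"
  by (simp add: agreeing_def)

text \<open>Two forms of the coset differ by an element of \<open>annihilator X\<close>, which
  vanishes at \<open>x\<close>; a dependent query cannot separate them.\<close>

lemma agreeing_insert_biannihilator:
  assumes x: "x \<in> biannihilator X" and "a0 \<in> vecs"
  shows "agreeing (insert x X) a0 = agreeing X a0"
proof -
  have "[inner a x = inner a0 x] (mod int p)" if a: "a \<in> agreeing X a0" for a
  proof -
    have diff: "[inner (axpy (-1) a0 a) z = inner a z - inner a0 z] (mod int p)" for z
      using inner_axpy_left[of "-1" a0 a z] by simp
    have "axpy (-1) a0 a \<in> annihilator X"
      using a diff
      by (simp add: annihilator_def agreeing_def axpy_in_vecs cong_dvd_iff[OF diff] cong_iff_dvd_diff[of "inner a _"])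
    then have "int p dvd inner (axpy (-1) a0 a) x"
      using x by (auto simp: annihilator_def inner_commute)
    then show ?thesis
      by (simp add: cong_dvd_iff[OF diff] cong_iff_dvd_diff)
  qed
  then show ?thesis by (auto simp: agreeing_def)
qed

text \<open>This is where answers at independent points become uniform. Adding multiples of a form
  \<open>c\<close> that vanishes on \<open>X\<close> but not at \<open>x\<close> attains every
  answer \<open>z\<close>, so each fiber is again a coset, whatever \<open>u\<close> is.\<close>

lemma agreeing_fiber:
  assumes x: "x \<in> vecs" "x \<notin> biannihilator X" and a0: "a0 \<in> vecs" and z: "z \<in> {0..<int p}"
  obtains a1 where "a1 \<in> vecs"
    "{a \<in> agreeing X a0. shifted u a x = z} = agreeing (insert x X) a1"
proof -
  obtain c where c: "c \<in> annihilator X" "\<not> int p dvd inner c x"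
    using x by (auto simp: annihilator_def inner_commute)
  then obtain m where m: "[m * inner c x = 1] (mod int p)"
    using ex_scale by blast
  \<comment> \<open>Solves \<open>inner a0 x + j * inner c x = z - u x\<close> modulo
    \<open>p\<close>, with \<open>m\<close> the inverse of \<open>inner c x\<close>.\<close>
  define j where "j = (z - u x - inner a0 x) * m"
  define a1 where "a1 = axpy j c a0"
  have a1: "[inner a1 y = inner a0 y + j * inner c y] (mod int p)" for y
    unfolding a1_def by (rule inner_axpy_left)
  have on_X: "[inner a1 y = inner a0 y] (mod int p)" if "y \<in> X" for y
  proof -
    have "int p dvd inner c y" using c that by (auto simp: annihilator_def)
    then have "[inner a0 y + j * inner c y = inner a0 y] (mod int p)"
      by (simp add: cong_iff_dvd_diff)
    then show ?thesis using a1 cong_trans by blast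
  qed
  have "[inner a0 x + (z - u x - inner a0 x) * (m * inner c x) =
      inner a0 x + (z - u x - inner a0 x) * 1] (mod int p)"
    using m by (intro cong_add cong_mult) auto
  then have on_x: "[inner a1 x = z - u x] (mod int p)"
    using a1[of x] by (simp add: j_def mult.assoc) (meson cong_trans)
  have shifted_iff: "shifted u a x = z \<longleftrightarrow> [inner a x = inner a1 x] (mod int p)" for a
  proof -
    have "shifted u a x = z \<longleftrightarrow> [u x + inner a x = z] (mod int p)"
      using z by (simp add: shifted_def cong_def)
    also have "\<dots> \<longleftrightarrow> [inner a x = z - u x] (mod int p)"
      by (simp add: cong_iff_dvd_diff algebra_simps)
    also have "\<dots> \<longleftrightarrow> [inner a x = inner a1 x] (mod int p)"
      using on_x by (meson cong_sym cong_trans)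
    finally show ?thesis .
  qed
  have "{a \<in> agreeing X a0. shifted u a x = z} = agreeing (insert x X) a1"
    unfolding shifted_iff agreeing_def using on_X on_x
    by (auto simp: cong_def)
  moreover have "a1 \<in> vecs" by (simp add: a1_def axpy_in_vecs)
  ultimately show ?thesis using that by blast
qed

text \<open>Translation by the difference of the base points is injective from one coset into the
  other. Used in both directions it shows that all cosets have equal size.\<close>

lemma card_agreeing_le:
  assumes "a0 \<in> vecs" "b0 \<in> vecs"
  shows "card (agreeing X a0) \<le> card (agreeing X b0)"
proof (rule card_inj_on_le)
  define d where "d = axpy (-1) a0 b0"
  have d: "[inner d z = inner b0 z - inner a0 z] (mod int p)" for z
    unfolding d_def using inner_axpy_left[of "-1" a0 b0 z] by simp
  show "inj_on (axpy 1 d) (agreeing X a0)"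
    by (rule inj_on_inverseI[of _ "axpy (-1) d"]) (auto simp: agreeing_def intro: axpy_cancel)
  show "axpy 1 d ` agreeing X a0 \<subseteq> agreeing X b0"
  proof
    fix b assume "b \<in> axpy 1 d ` agreeing X a0"
    then obtain a where a: "a \<in> agreeing X a0" "b = axpy 1 d a" by blast
    have "[inner b z = inner b0 z] (mod int p)" if "z \<in> X" for z
    proof -
      have "[inner b z = inner a z + 1 * inner d z] (mod int p)"
        unfolding a by (rule inner_axpy_left)
      also have "[inner a z + 1 * inner d z = inner a0 z + 1 * (inner b0 z - inner a0 z)] (mod int p)"
        using a that d by (intro cong_add cong_mult) (auto simp: agreeing_def)
      finally show ?thesis by simp
    qed
    then show "b \<in> agreeing X b0"
      by (simp add: agreeing_def a axpy_in_vecs)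
  qed
qed (rule finite_agreeing)

lemma card_split_shifted:
  "card {a \<in> agreeing X a0. P a (shifted u a x)} =
     (\<Sum>z\<in>{0..<int p}. card {a \<in> agreeing X a0. shifted u a x = z \<and> P a z})"
proof -
  have "{a \<in> agreeing X a0. P a (shifted u a x)} =
      (\<Union>z\<in>{0..<int p}. {a \<in> agreeing X a0. shifted u a x = z \<and> P a z})"
    using p_pos by (auto simp: shifted_def)
  then show ?thesis
    by (simp only:) (subst card_UN_disjoint, auto simp: finite_agreeing)
qed

text \<open>The set \<open>E\<close> of erased points may miss the zero vector, which can be queried before anything
  has been erased; this is where both functions have to vanish.\<close>

lemma card_accepting_eq:
  fixes u v :: "(nat \<Rightarrow> int) \<Rightarrow> int"
  assumes zero: "u (reduce (\<lambda>_. 0)) = 0" "v (reduce (\<lambda>_. 0)) = 0"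
    and "p ^ q \<le> t"
  shows "\<lbrakk>query_points T \<subseteq> vecs; set qs \<subseteq> vecs; a0 \<in> vecs; b0 \<in> vecs;
      E \<subseteq> biannihilator (set qs); biannihilator (set qs) \<subseteq> insert (reduce (\<lambda>_. 0)) E;
      \<And>a. a \<in> agreeing (set qs) a0 \<Longrightarrow>
        snd (exec (span_adversary t) (shifted u a) qs E T) + length qs \<le> q\<rbrakk> \<Longrightarrow>
    card {a \<in> agreeing (set qs) a0. fst (exec (span_adversary t) (shifted u a) qs E T)} =
    card {b \<in> agreeing (set qs) b0. fst (exec (span_adversary t) (shifted v b) qs E T)}"
proof (induction T arbitrary: qs a0 b0 E)
  case (Decide b)
  have "card (agreeing (set qs) a0) = card (agreeing (set qs) b0)"
    using Decide.prems by (intro antisym card_agreeing_le)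
  then show ?case by (cases b) simp_all
next
  case (Query x k)
  define qs' where "qs' = qs @ [x]"
  define E' where "E' = E \<union> span_adversary t qs'"
  have x: "x \<in> vecs" and qs': "set qs' \<subseteq> vecs" "set qs' = insert x (set qs)"
    using Query.prems by (auto simp: qs'_def)
  have k: "query_points (k c) \<subseteq> vecs" for c
    using Query.prems(1) by auto
  have exec_fst: "fst (exec (span_adversary t) f qs E (Query x k)) =
      fst (exec (span_adversary t) f qs' E' (k (if x \<in> E then None else Some (f x))))" for f
    unfolding qs'_def E'_def by (rule fst_exec_Query)
  have exec_snd: "snd (exec (span_adversary t) f qs E (Query x k)) + length qs =
      snd (exec (span_adversary t) f qs' E' (k (if x \<in> E then None else Some (f x)))) + length qs'"
    for f
    unfolding qs'_def E'_def by (subst snd_exec_Query) simp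
  \<comment> \<open>The query bound, applied to the form \<open>a0\<close> alone, shows that the
    guard in \<open>span_adversary\<close> still holds.\<close>
  have "length qs' \<le> q"
    using Query.prems(7)[OF agreeing_self[OF Query.prems(3)]] unfolding exec_snd by simp
  then have "p ^ length qs' \<le> t"
    using \<open>p ^ q \<le> t\<close> p_pos power_increasing[of "length qs'" q p] by simp
  then have "span_adversary t qs' = biannihilator (set qs')"
    using qs'(1) by (simp add: span_adversary_def)
  moreover have "biannihilator (set qs) \<subseteq> biannihilator (set qs')"
    unfolding qs'(2) by (intro annihilator_antimono) auto
  ultimately have E': "E' \<subseteq> biannihilator (set qs')"
      "biannihilator (set qs') \<subseteq> insert (reduce (\<lambda>_. 0)) E'"
    using Query.prems(5) by (auto simp: E'_def)
  show ?case
  proof (cases "x \<in> biannihilator (set qs)")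
    case True
    \<comment> \<open>Inside the span the answer is the same for every form: erased, or the value at
      zero, which is 0 for \<open>u\<close> and for \<open>v\<close>. The set of candidate forms
      does not shrink.\<close>
    define c where "c = (if x \<in> E then None else Some (0::int))"
    have agree: "agreeing (set qs') a = agreeing (set qs) a" if "a \<in> vecs" for a
      unfolding qs'(2) using True that by (rule agreeing_insert_biannihilator)
    have answer: "(if x \<in> E then None else Some (shifted w a x)) = c"
      if "w (reduce (\<lambda>_. 0)) = 0" for w a
    proof (cases "x \<in> E")
      case False
      then have "x = reduce (\<lambda>_. 0)"
        using True Query.prems(6) by auto
      moreover have "inner a (reduce (\<lambda>_. 0)) = 0"
        by (simp add: inner_def reduce_def)
      ultimately show ?thesis
        using that False by (simp add: c_def shifted_def)
    qed (simp add: c_def)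
    have "card {a \<in> agreeing (set qs') a0. fst (exec (span_adversary t) (shifted u a) qs' E' (k c))} =
        card {b \<in> agreeing (set qs') b0. fst (exec (span_adversary t) (shifted v b) qs' E' (k c))}"
    proof (rule Query.IH[OF rangeI k qs'(1) Query.prems(3,4) E'])
      fix a assume "a \<in> agreeing (set qs') a0"
      then have "a \<in> agreeing (set qs) a0" using agree Query.prems(3) by simp
      from Query.prems(7)[OF this] show
        "snd (exec (span_adversary t) (shifted u a) qs' E' (k c)) + length qs' \<le> q"
        unfolding exec_snd answer[of u, OF zero(1)] .
    qed
    then show ?thesis
      unfolding exec_fst answer[of u, OF zero(1)] answer[of v, OF zero(2)]
      using agree Query.prems(3,4) by simp
  next
    case False
    then have "x \<notin> E" using Query.prems(5) by auto
    then have exec_fst: "fst (exec (span_adversary t) f qs E (Query x k)) =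
        fst (exec (span_adversary t) f qs' E' (k (Some (f x))))" for f
      using exec_fst by simp
    \<comment> \<open>Both runs are compared under the same answer \<open>z\<close>. Since
      \<open>u\<close> and \<open>v\<close> may require different forms to produce it, the fibers
      have different base points \<open>a1\<close> and \<open>b1\<close>; this is why the induction
      is over two arbitrary base points.\<close>
    have fiber_eq: "card {a \<in> agreeing (set qs) a0. shifted u a x = z \<and>
          fst (exec (span_adversary t) (shifted u a) qs' E' (k (Some z)))} =
        card {b \<in> agreeing (set qs) b0. shifted v b x = z \<and>
          fst (exec (span_adversary t) (shifted v b) qs' E' (k (Some z)))}"
      if z: "z \<in> {0..<int p}" for z
    proof -
      obtain a1 where a1: "a1 \<in> vecs"
        "{a \<in> agreeing (set qs) a0. shifted u a x = z} = agreeing (set qs') a1"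
        using agreeing_fiber[OF x False Query.prems(3) z] unfolding qs'(2) by metis
      obtain b1 where b1: "b1 \<in> vecs"
        "{b \<in> agreeing (set qs) b0. shifted v b x = z} = agreeing (set qs') b1"
        using agreeing_fiber[OF x False Query.prems(4) z] unfolding qs'(2) by metis
      have "card {a \<in> agreeing (set qs') a1.
            fst (exec (span_adversary t) (shifted u a) qs' E' (k (Some z)))} =
          card {b \<in> agreeing (set qs') b1.
            fst (exec (span_adversary t) (shifted v b) qs' E' (k (Some z)))}"
      proof (rule Query.IH[OF rangeI k qs'(1) a1(1) b1(1) E'])
        fix a assume "a \<in> agreeing (set qs') a1"
        then have a: "a \<in> agreeing (set qs) a0" "shifted u a x = z"
          unfolding a1(2)[symmetric] by auto
        show "snd (exec (span_adversary t) (shifted u a) qs' E' (k (Some z))) + length qs' \<le> q"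
          using Query.prems(7)[OF a(1)] \<open>x \<notin> E\<close> a(2) unfolding exec_snd by simp
      qed
      then show ?thesis
        unfolding a1(2)[symmetric] b1(2)[symmetric] by (simp add: conj_assoc)
    qed
    show ?thesis
      unfolding exec_fst
        card_split_shifted[where P = "\<lambda>a z. fst (exec _ (shifted _ a) _ _ (k (Some z)))"]
      by (intro sum.cong refl fiber_eq)
  qed
qed

section \<open>Homomorphisms, and the distance of the quadratic functions from them\<close>

lemma shifted_in_range: "shifted u a \<in> vecs \<rightarrow> carrier (Fp p)"
  using p_pos by (auto simp: shifted_def carrier_Fp)

lemma mult_Fp: "x \<otimes>\<^bsub>Fp p\<^esub> y = (x + y) mod int p"
  by (simp add: mult_integer_mod_group)

lemma mult_Fpn: "x \<otimes>\<^bsub>Fpn p n\<^esub> y = axpy 1 y x"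
  by (simp add: mult_Fp axpy_def reduce_def)

lemma shifted_zero_hom: "shifted (\<lambda>_. 0) a \<in> hom (Fpn p n) (Fp p)"
proof (rule homI)
  fix x y
  have "[inner a (axpy 1 y x) = inner a x + inner a y] (mod int p)"
    using inner_axpy_right[of a 1 y x] by simp
  then show "shifted (\<lambda>_. 0) a (x \<otimes>\<^bsub>Fpn p n\<^esub> y) =
      shifted (\<lambda>_. 0) a x \<otimes>\<^bsub>Fp p\<^esub> shifted (\<lambda>_. 0) a y"
    unfolding mult_Fpn mult_Fp by (simp add: shifted_def cong_def mod_simps)
qed (use p_pos in \<open>auto simp: shifted_def carrier_Fp\<close>)

text \<open>Additive maps over F_p are linear: induction gives natural multiples, and an integer
  \<open>j\<close> is replaced by its nonnegative residue.\<close>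

lemma hom_axpy:
  assumes h: "h \<in> hom (Fpn p n) (Fp p)" and v: "v \<in> vecs" and x: "x \<in> vecs"
  shows "[h (axpy j v x) = h x + j * h v] (mod int p)"
proof -
  have nat: "[h (axpy (int m) v x) = h x + int m * h v] (mod int p)" for m
  proof (induction m)
    case 0
    then show ?case using x by (simp add: axpy_zero)
  next
    case (Suc m)
    have "h (axpy (int (Suc m)) v x) = h (axpy (int m) v x \<otimes>\<^bsub>Fpn p n\<^esub> v)"
      unfolding mult_Fpn by (simp add: axpy_axpy)
    also have "\<dots> = (h (axpy (int m) v x) + h v) mod int p"
      using hom_mult[OF h, of "axpy (int m) v x" v] v
      unfolding carrier_Fpn mult_Fp by (simp add: axpy_in_vecs)
    also have "[\<dots> = (h x + int m * h v) + h v] (mod int p)"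
      using Suc by (simp add: cong_add)
    finally show ?case by (simp add: algebra_simps)
  qed
  define m where "m = nat (j mod int p)"
  have m: "[j = int m] (mod int p)"
    using p_pos by (simp add: m_def)
  have "[h (axpy j v x) = h x + int m * h v] (mod int p)"
    using nat axpy_coeff_cong[OF m] by simp
  also have "[h x + int m * h v = h x + j * h v] (mod int p)"
    using m by (intro cong_add cong_mult) (auto intro: cong_sym)
  finally show ?thesis .
qed

text \<open>The \<open>p\<close> translates of \<open>B \<inter> T\<close> by multiples of
  \<open>v\<close> stay in \<open>B\<close> and are pairwise disjoint, since \<open>T\<close> meets
  each line in \<open>B\<close> at most once.\<close>

lemma card_transversal_le:
  assumes B: "B \<subseteq> vecs" and stable: "\<And>x j. x \<in> B \<Longrightarrow> axpy j v x \<in> B"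
    and transversal: "\<And>x j. \<lbrakk>x \<in> B; x \<in> T; axpy j v x \<in> T\<rbrakk> \<Longrightarrow> int p dvd j"
  shows "p * card (B \<inter> T) \<le> card B"
proof -
  have "inj_on (\<lambda>(j, x). axpy j v x) ({0..<int p} \<times> (B \<inter> T))"
  proof (rule inj_onI, clarify)
    fix j x k y
    assume jk: "j \<in> {0..<int p}" "k \<in> {0..<int p}" and x: "x \<in> B" "x \<in> T" and y: "y \<in> B" "y \<in> T"
      and eq: "axpy j v x = axpy k v y"
    have "y = axpy (- k) v (axpy k v y)"
      using y B by (intro axpy_cancel[symmetric]) auto
    also have "\<dots> = axpy (j - k) v x"
      unfolding eq[symmetric] by (simp add: axpy_axpy)
    finally have y_eq: "y = axpy (j - k) v x" .
    then have "int p dvd j - k"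
      using transversal x y by blast
    then have "j mod int p = k mod int p"
      by (simp add: mod_eq_dvd_iff)
    then have "j = k" using jk by simp
    then show "j = k \<and> x = y"
      using y_eq x B by (auto simp: axpy_zero)
  qed
  moreover have "(\<lambda>(j, x). axpy j v x) ` ({0..<int p} \<times> (B \<inter> T)) \<subseteq> B"
    using stable by auto
  ultimately have "card ({0..<int p} \<times> (B \<inter> T)) \<le> card B"
    using B finite_vecs by (meson card_inj_on_le finite_subset)
  then show ?thesis by (simp add: card_cartesian_product)
qed

text \<open>One product would not suffice at the largest \<open>\<epsilon>\<close>: for
  \<open>p = 2\<close>, \<open>x 0 * x 1\<close> vanishes on exactly 3/4 of the points, which is
  \<open>(p + 1) / (2 * p)\<close>. The second product makes the inequality strict.\<close>

definition quad :: "(nat \<Rightarrow> int) \<Rightarrow> int" where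
  "quad x = x 0 * x 1 + x 2 * x 3"

lemma axpy_axis_cong:
  "k < n \<Longrightarrow> [axpy j (axis i) x k = (if k = i then x k + j else x k)] (mod int p)"
  using axpy_cong[of k j "axis i" x] by (auto simp: axis_def)

lemma quad_axpy_axis:
  assumes "4 \<le> n" "i \<in> {0, 2}"
  shows "[quad (axpy j (axis (Suc i)) x) = quad x + j * x i] (mod int p)"
proof -
  let ?y = "\<lambda>k. if k = Suc i then x k + j else x k"
  have "[quad (axpy j (axis (Suc i)) x) = quad ?y] (mod int p)"
    unfolding quad_def using assms(1) by (intro cong_add cong_mult axpy_axis_cong) auto
  also have "quad ?y = quad x + j * x i"
    using assms(2) by (auto simp: quad_def algebra_simps numeral_3_eq_3)
  finally show ?thesis .
qed

text \<open>Along a line in direction \<open>Suc i\<close> the difference from a homomorphism is affine with slope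
  \<open>x i\<close> minus a constant, so outside a hyperplane it vanishes at most once per line.\<close>

lemma agree_twice:
  assumes n: "4 \<le> n" and i: "i \<in> {0, 2}" and h: "h \<in> hom (Fpn p n) (Fp p)" and x: "x \<in> vecs"
    and agree: "shifted quad a x = h x"
      "shifted quad a (axpy j (axis (Suc i)) x) = h (axpy j (axis (Suc i)) x)"
  shows "int p dvd j * (x i - (h (reduce (axis (Suc i))) - a (Suc i)))"
proof -
  let ?e = "axis (Suc i)" and ?y = "axpy j (axis (Suc i)) x"
  have Suc_i: "Suc i < n" using n i by auto
  \<comment> \<open>\<open>hom_axpy\<close> asks for a direction in \<open>vecs\<close>; replacing
    the unit vector by its normal form does not change the translate.\<close>
  have "?y = axpy j (reduce ?e) x"
    by (auto simp: axpy_def reduce_def fun_eq_iff) (metis mod_add_right_eq mod_mult_right_eq)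
  then have "[h ?y = h x + j * h (reduce ?e)] (mod int p)"
    using hom_axpy[OF h reduce_in_vecs x] by simp
  moreover have "[h ?y = quad ?y + inner a ?y] (mod int p)" "[h x = quad x + inner a x] (mod int p)"
    unfolding agree[symmetric] by (simp_all add: shifted_def)
  moreover have "[quad ?y + inner a ?y = (quad x + j * x i) + (inner a x + j * a (Suc i))] (mod int p)"
    using quad_axpy_axis[OF n i] inner_axpy_right[of a j ?e x] Suc_i
    by (intro cong_add) (auto simp: inner_axis)
  ultimately have "[(quad x + j * x i) + (inner a x + j * a (Suc i)) =
      (quad x + inner a x) + j * h (reduce ?e)] (mod int p)"
    by (meson cong_add_rcancel cong_sym cong_trans)
  then show ?thesis
    by (simp add: cong_iff_dvd_diff algebra_simps)
qed

text \<open>The first product controls the points off the hyperplane \<open>Z\<close>, the second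
  those of \<open>Z\<close> off \<open>W\<close>. Only \<open>W\<close>, of density at most
  \<open>1 / p^2\<close>, remains, so \<open>p * card T\<close> is at most
  \<open>card vecs + (p - 1) * card W\<close>.\<close>

lemma card_agree:
  assumes n: "4 \<le> n" and h: "h \<in> hom (Fpn p n) (Fp p)"
  shows "2 * p * card {x \<in> vecs. shifted quad a x = h x} < (p + 1) * card vecs"
proof -
  define T where "T = {x \<in> vecs. shifted quad a x = h x}"
  \<comment> \<open>The slope of \<open>h\<close> minus that of the form \<open>a\<close> in
    direction \<open>Suc i\<close>; by \<open>agree_twice\<close>, lines are exceptional only where
    \<open>x i\<close> is congruent to it.\<close>
  define r where "r i = h (reduce (axis (Suc i))) - a (Suc i)" for i
  define Z where "Z = {x \<in> vecs. int p dvd x 0 - r 0}"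
  define W where "W = {x \<in> Z. int p dvd x 2 - r 2}"
  have dvd_axpy: "int p dvd axpy j (axis i) x k - c \<longleftrightarrow> int p dvd (if k = i then x k + j else x k) - c"
    if "k < n" for i j k x c
    using axpy_axis_cong[OF that, of j i x] by (intro cong_dvd_iff cong_diff) auto
  have cancel: "int p dvd j" if "int p dvd y - c" "int p dvd y + j - c" for y j c
    using dvd_diff[OF that(2,1)] by simp
  have "p * card (vecs \<inter> {x. int p dvd x 0 - r 0}) \<le> card vecs"
    using n by (intro card_transversal_le[where v = "axis 0"])
      (auto simp: axpy_in_vecs dvd_axpy intro: cancel)
  moreover have "vecs \<inter> {x. int p dvd x 0 - r 0} = Z" by (auto simp: Z_def)
  ultimately have card_Z: "p * card Z \<le> card vecs" by simp
  have "p * card (Z \<inter> {x. int p dvd x 2 - r 2}) \<le> card Z"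
    using n by (intro card_transversal_le[where v = "axis 2"])
      (auto simp: Z_def axpy_in_vecs dvd_axpy intro: cancel)
  moreover have "Z \<inter> {x. int p dvd x 2 - r 2} = W" by (auto simp: W_def)
  ultimately have card_W: "p * card W \<le> card Z" by simp
  have dvd_j: "int p dvd j"
    if "i \<in> {0, 2}" "x \<in> T" "axpy j (axis (Suc i)) x \<in> T" "\<not> int p dvd x i - r i" for i j x
    using agree_twice[OF n that(1) h, of x a j] that(2-4) prime_int_p
    by (auto simp: T_def r_def prime_dvd_mult_iff)
  \<comment> \<open>Moving coordinate 1 or 3 alters neither \<open>x 0\<close> nor
    \<open>x 2\<close>, so \<open>Z\<close> and \<open>W\<close> are unions of such lines. Off
    \<open>Z\<close>, and on \<open>Z\<close> off \<open>W\<close>, the respective slope is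
    invertible.\<close>
  have off_Z: "p * card ((vecs - Z) \<inter> T) \<le> card (vecs - Z)"
    using n dvd_j[of 0] by (intro card_transversal_le[where v = "axis (Suc 0)"])
      (auto simp: Z_def axpy_in_vecs dvd_axpy)
  have off_W: "p * card ((Z - W) \<inter> T) \<le> card (Z - W)"
    using n dvd_j[of 2] by (intro card_transversal_le[where v = "axis (Suc 2)"])
      (auto simp: Z_def W_def axpy_in_vecs dvd_axpy)
  have fin: "finite Z" "finite W" "finite T" and sub: "Z \<subseteq> vecs" "W \<subseteq> Z"
    using finite_vecs by (auto simp: Z_def W_def T_def)
  \<comment> \<open>Agreement on \<open>W\<close> is not analysed: all of \<open>W\<close> is
    counted.\<close>
  have "card T \<le> card (((vecs - Z) \<inter> T \<union> (Z - W) \<inter> T) \<union> W)"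
    using fin finite_vecs by (intro card_mono) (auto simp: T_def)
  also have "\<dots> \<le> card ((vecs - Z) \<inter> T) + card ((Z - W) \<inter> T) + card W"
    by (meson card_Un_le add_right_mono order_trans)
  finally have "p * card T \<le> p * (card ((vecs - Z) \<inter> T) + card ((Z - W) \<inter> T) + card W)"
    by simp
  also have "\<dots> \<le> card (vecs - Z) + card (Z - W) + p * card W"
    using off_Z off_W by (simp add: distrib_left)
  \<comment> \<open>Adding \<open>card W\<close> makes the differences telescope without subtraction
    on naturals.\<close>
  also have "\<dots> + card W = card vecs + p * card W"
    using fin sub finite_vecs card_mono[OF finite_vecs sub(1)] card_mono[OF fin(1) sub(2)]
    by (simp add: card_Diff_subset)
  finally have T_le: "p * card T + card W \<le> card vecs + p * card W" by simp
  define P N w where "P = real p" and "N = real (card vecs)" and "w = real (card W)"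
  have P: "2 \<le> P" and N: "0 < N"
    using p_ge_2 finite_vecs vecs_nonempty by (auto simp: P_def N_def card_gt_0_iff)
  have "P * real (card T) + w \<le> N + P * w"
    using T_le unfolding P_def N_def w_def by (metis of_nat_add of_nat_le_iff of_nat_mult)
  moreover have "P * (P * w) \<le> N"
    using order_trans[OF mult_le_mono2[OF card_W] card_Z] unfolding P_def N_def w_def
    by (metis of_nat_le_iff of_nat_mult)
  ultimately have le: "P * real (card T) \<le> N + (P - 1) * w" "P\<^sup>2 * w \<le> N"
    by (simp_all add: algebra_simps power2_eq_square)
  \<comment> \<open>The source of strictness, which admits the endpoint
    \<open>\<epsilon> = (p - 1) / (2 * p)\<close> although \<open>eps_far\<close> demands a strict
    inequality.\<close>
  have P2: "2 < P\<^sup>2"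
    using mult_mono[OF P P] P by (simp add: power2_eq_square)
  have "P\<^sup>2 * (2 * (P * real (card T))) \<le> P\<^sup>2 * (2 * (N + (P - 1) * w))"
    using le(1) by (intro mult_left_mono) auto
  also have "\<dots> = 2 * P\<^sup>2 * N + (P - 1) * (2 * (P\<^sup>2 * w))"
    by (simp add: algebra_simps)
  also have "\<dots> \<le> 2 * P\<^sup>2 * N + (P - 1) * (2 * N)"
    using le(2) P by (intro add_left_mono mult_left_mono) auto
  also have "\<dots> < 2 * P\<^sup>2 * N + (P - 1) * (P\<^sup>2 * N)"
    using P2 P N by (intro add_strict_left_mono mult_strict_left_mono mult_strict_right_mono) auto
  also have "\<dots> = P\<^sup>2 * ((P + 1) * N)"
    by (simp add: algebra_simps)
  finally have "2 * (P * real (card T)) < (P + 1) * N"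
    using P2 by (simp only: mult_less_cancel_left_pos)
  then have "real (2 * p * card T) < real ((p + 1) * card vecs)"
    by (simp add: P_def N_def algebra_simps)
  then show ?thesis unfolding T_def of_nat_less_iff .
qed

lemma shifted_quad_far:
  assumes n: "4 \<le> n" and \<epsilon>: "\<epsilon> \<le> (real p - 1) / (2 * real p)"
  shows "eps_far vecs (hom (Fpn p n) (Fp p)) \<epsilon> (shifted quad a)"
  unfolding eps_far_def
proof
  fix h assume h: "h \<in> hom (Fpn p n) (Fp p)"
  let ?T = "{x \<in> vecs. shifted quad a x = h x}"
  define N where "N = real (card vecs)"
  have N: "0 < N"
    using finite_vecs vecs_nonempty by (auto simp: N_def card_gt_0_iff)
  have "measure_pmf.prob (pmf_of_set vecs) {x. shifted quad a x \<noteq> h x} =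
      real (card (vecs - ?T)) / N"
    unfolding N_def measure_pmf_of_set[OF vecs_nonempty finite_vecs]
    by (rule arg_cong[where f = "\<lambda>S. real (card S) / _"]) auto
  also have "\<dots> = (N - real (card ?T)) / N"
    using finite_vecs by (simp add: card_Diff_subset card_mono of_nat_diff N_def)
  finally have prob: "measure_pmf.prob (pmf_of_set vecs) {x. shifted quad a x \<noteq> h x} =
      (N - real (card ?T)) / N" .
  have "real (2 * p * card ?T) < real ((p + 1) * card vecs)"
    using card_agree[OF n h] by (simp only: of_nat_less_iff)
  then have "2 * real p * real (card ?T) < (real p + 1) * N"
    by (simp add: N_def algebra_simps)
  then have "(real p - 1) / (2 * real p) < (N - real (card ?T)) / N"
    using N p_pos by (simp add: field_simps)
  then show "\<epsilon> < measure_pmf.prob (pmf_of_set vecs) {x. shifted quad a x \<noteq> h x}"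
    unfolding prob using \<epsilon> by simp
qed

section \<open>Averaging over the coins, and the lower bound\<close>

lemma sum_prob_eq:
  fixes M :: "'t pmf"
  assumes "finite I" and "\<And>T. T \<in> set_pmf M \<Longrightarrow> card {a \<in> I. P a T} = card {a \<in> I. Q a T}"
  shows "(\<Sum>a\<in>I. measure_pmf.prob M {T. P a T}) = (\<Sum>a\<in>I. measure_pmf.prob M {T. Q a T})"
proof -
  \<comment> \<open>Exchanging sum and expectation turns the total probability into an expected
    count, so an equality for each deterministic tree carries over to the randomized tester.\<close>
  have sum_prob: "(\<Sum>a\<in>I. measure_pmf.prob M {T. R a T}) =
      measure_pmf.expectation M (\<lambda>T. real (card {a \<in> I. R a T}))" for R
  proof -
    have "(\<Sum>a\<in>I. measure_pmf.prob M {T. R a T}) =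
        (\<Sum>a\<in>I. measure_pmf.expectation M (indicator {T. R a T}))"
      by simp
    also have "\<dots> = measure_pmf.expectation M (\<lambda>T. \<Sum>a\<in>I. indicator {T. R a T} T)"
      by (rule Bochner_Integration.integral_sum[symmetric])
        (auto intro!: measure_pmf.integrable_const_bound[where B = 1] simp: indicator_def)
    also have "(\<lambda>T. \<Sum>a\<in>I. indicator {T. R a T} T) = (\<lambda>T. real (card {a \<in> I. R a T}))"
      using assms(1) by (auto simp: indicator_def of_bool_def sum.If_cases Int_def)
    finally show ?thesis .
  qed
  show ?thesis
    unfolding sum_prob by (intro integral_cong_AE) (use assms(2) in \<open>auto simp: AE_measure_pmf_iff\<close>)
qed

text \<open>If \<open>p ^ q \<le> t\<close>, the acceptance probabilities summed over all forms
  coincide for the homomorphisms and the quadratic functions, yet they average at least 2/3 for the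
  former and at most 1/3 for the latter.\<close>

lemma query_lower_bound:
  assumes n: "4 \<le> n" and \<epsilon>: "\<epsilon> \<le> (real p - 1) / (2 * real p)"
    and tester: "homomorphism_tester p n t \<epsilon> M"
    and queries: "makes_at_most (carrier (Fpn p n)) (carrier (Fp p)) t M q"
  shows "t < p ^ q"
proof (rule ccontr)
  assume "\<not> t < p ^ q"
  then have pq: "p ^ q \<le> t" by simp
  let ?A = "span_adversary t"
  have points: "query_points T \<subseteq> vecs" if "T \<in> set_pmf M" for T
    using tester that
    unfolding homomorphism_tester_def online_erasure_resilient_tester_def carrier_Fpn by blast
  have card_eq: "card {a \<in> vecs. accepts ?A (shifted quad a) T} =
      card {a \<in> vecs. accepts ?A (shifted (\<lambda>_. 0) a) T}" if T: "T \<in> set_pmf M" for T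
  proof -
    obtain a0 where a0: "a0 \<in> vecs" using vecs_nonempty by blast
    have "card {a \<in> agreeing (set []) a0. fst (exec ?A (shifted quad a) [] {} T)} =
        card {a \<in> agreeing (set []) a0. fst (exec ?A (shifted (\<lambda>_. 0) a) [] {} T)}"
    proof (rule card_accepting_eq[OF _ _ pq points[OF T]])
      show "quad (reduce (\<lambda>_. 0)) = 0"
        using n by (simp add: quad_def reduce_def)
    next
      fix a
      show "snd (exec ?A (shifted quad a) [] {} T) + length [] \<le> q"
        using queries shifted_in_range span_adversary T
        unfolding makes_at_most_def carrier_Fpn num_queries_def by auto
    qed (use a0 biannihilator_empty in auto)
    moreover have "agreeing (set []) a0 = vecs" by (simp add: agreeing_def)
    ultimately show ?thesis by (simp add: accepts_def)
  qed
  have accept_hom: "2/3 \<le> measure_pmf.prob M {T. accepts ?A (shifted (\<lambda>_. 0) a) T}" for a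
    using tester shifted_in_range span_adversary shifted_zero_hom
    unfolding homomorphism_tester_def online_erasure_resilient_tester_def carrier_Fpn by blast
  have accept_far: "measure_pmf.prob M {T. accepts ?A (shifted quad a) T} \<le> 1/3" for a
  proof -
    have "2/3 \<le> measure_pmf.prob M {T. \<not> accepts ?A (shifted quad a) T}"
      using tester shifted_in_range span_adversary shifted_quad_far[OF n \<epsilon>]
      unfolding homomorphism_tester_def online_erasure_resilient_tester_def carrier_Fpn by blast
    also have "{T. \<not> accepts ?A (shifted quad a) T} = UNIV - {T. accepts ?A (shifted quad a) T}"
      by auto
    finally show ?thesis
      using measure_pmf.prob_compl[of "{T. accepts ?A (shifted quad a) T}" M] by simp
  qed
  have "real (card vecs) * (2/3) \<le>
      (\<Sum>a\<in>vecs. measure_pmf.prob M {T. accepts ?A (shifted (\<lambda>_. 0) a) T})"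
    using accept_hom by (intro sum_bounded_below)
  also have "\<dots> = (\<Sum>a\<in>vecs. measure_pmf.prob M {T. accepts ?A (shifted quad a) T})"
    by (intro sum_prob_eq finite_vecs) (simp add: card_eq)
  also have "\<dots> \<le> real (card vecs) * (1/3)"
    using accept_far by (intro sum_bounded_above)
  finally show False
    using finite_vecs vecs_nonempty by (simp add: card_gt_0_iff)
qed

end

theorem theorem1p6:
  "\<exists>c::real. c > 0 \<and>
     (\<forall>p::nat. prime p \<longrightarrow>
       (\<exists>n0::nat. \<forall>n\<ge>n0. \<forall>\<epsilon>::real. 0 < \<epsilon> \<and> \<epsilon> \<le> (real p - 1) / (2 * real p) \<longrightarrow>
         (\<forall>t::nat. t \<ge> 1 \<longrightarrow>
           (\<forall>M q. homomorphism_tester p n t \<epsilon> M \<and>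
                  makes_at_most (carrier (Fpn p n)) (carrier (Fp p)) t M q \<longrightarrow>
                  real q \<ge> c * log (real p) (real t)))))"
proof (intro exI[of _ "1::real"] exI[of _ "4::nat"] conjI allI impI)
  \<comment> \<open>The constant is 1 because \<open>t < p ^ q\<close>, and the threshold is 4
    because \<open>quad\<close> reads four coordinates.\<close>
  fix p n :: nat and \<epsilon> :: real and t :: nat and M q
  assume prime: "prime p" and n: "4 \<le> n"
    and \<epsilon>: "0 < \<epsilon> \<and> \<epsilon> \<le> (real p - 1) / (2 * real p)" and t: "1 \<le> t"
    and M: "homomorphism_tester p n t \<epsilon> M \<and>
      makes_at_most (carrier (Fpn p n)) (carrier (Fp p)) t M q"
  interpret prime_vector_space p n using prime by unfold_locales
  have "t < p ^ q" using query_lower_bound n \<epsilon> M by blast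
  then have "real t \<le> real p ^ q" by (metis less_imp_le of_nat_le_iff of_nat_power)
  then have "log (real p) (real t) \<le> log (real p) (real p ^ q)"
    using t p_ge_2 by (subst log_le_cancel_iff) auto
  also have "\<dots> = real q" using p_ge_2 by (simp add: log_nat_power)
  finally show "real q \<ge> 1 * log (real p) (real t)" by simp
qed simp

end
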